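(* Let $\alpha$ be an irrational number. For $\lambda>0$ let $f_\lambda(r)=\lambda r(1-r)$ for $r>0$, let $H:S^1\to S^1$, $H([\theta])=[\theta+\alpha]$, and let $F_\lambda(r,[\theta])=(f_\lambda(r),H([\theta]))$ for $r>0$, $[\theta]\in S^1$. Then there exists $\lambda_0>3$ such that for each $\lambda$ with $3<\lambda<\lambda_0$ there exist circles $\Gamma_\lambda^1,\Gamma_\lambda^2\subset(0,\infty)\times S^1$, invariant with respect to $F_\lambda^2$, such that: (1) $\Gamma_\lambda^1\cap\Gamma_\lambda^2=\emptyset$; (2) $F_\lambda(\Gamma_\lambda^1)=\Gamma_\lambda^2$ and $F_\lambda(\Gamma_\lambda^2)=\Gamma_\lambda^1$; (3) $F_\lambda(\Gamma_\lambda^1\cup\Gamma_\lambda^2)=\Gamma_\lambda^1\cup\Gamma_\lambda^2$.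
   Context: $S^1$ is identified with $\mathbf{R}/\mathbf{Z}$, and $[\theta]$ denotes the class of $\theta\in\mathbf{R}$ in $\mathbf{R}/\mathbf{Z}$. The map $F_\lambda$ is defined on $(0,\infty)\times S^1$ with values in $\mathbf{R}\times S^1$, and $F_\lambda^2=F_\lambda\circ F_\lambda$ (where defined). A circle is a subset of $\mathbf{R}\times S^1$ homeomorphic to $S^1$ (with the subspace topology); a circle $\Gamma$ is invariant with respect to $F_\lambda^2$ if $F_\lambda^2$ is defined on $\Gamma$ and $F_\lambda^2(\Gamma)=\Gamma$. *)

theory Defs
  imports "HOL-Analysis.Analysis"
begin

quotient_type circ = real / "\<lambda>x y :: real. x - y \<in> \<int>"
  morphisms rep_circ circ_class
proof (rule equivpI)
  show "reflp (\<lambda>x y :: real. x - y \<in> \<int>)"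
    by (simp add: reflp_def)
  show "symp (\<lambda>x y :: real. x - y \<in> \<int>)"
  proof (rule sympI)
    fix x y :: real
    assume "x - y \<in> \<int>"
    then have "- (x - y) \<in> \<int>" by (simp only: minus_in_Ints_iff)
    then show "y - x \<in> \<int>" by simp
  qed
  show "transp (\<lambda>x y :: real. x - y \<in> \<int>)"
  proof (rule transpI)
    fix x y z :: real
    assume "x - y \<in> \<int>" "y - z \<in> \<int>"
    then have "(x - y) + (y - z) \<in> \<int>" by (rule Ints_add)
    then show "x - z \<in> \<int>" by simp
  qed
qed

text \<open>\<^typ>\<open>circ\<close> is \<open>\<real>/\<int>\<close> with the quotient topology, and \<open>circ_class \<theta>\<close> is \<open>[\<theta>]\<close>.\<close>

instantiation circ :: topological_space
begin

definition open_circ :: "circ set \<Rightarrow> bool" where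
  "open_circ U \<longleftrightarrow> open (circ_class -` U)"

instance
  by standard (auto simp: open_circ_def vimage_Union)

end

lift_definition rot :: "real \<Rightarrow> circ \<Rightarrow> circ" is "\<lambda>\<alpha> \<theta>. \<theta> + \<alpha>"
  by simp

lemma rot_circ_class: "rot \<alpha> (circ_class \<theta>) = circ_class (\<theta> + \<alpha>)"
  by (rule rot.abs_eq)

definition logistic :: "real \<Rightarrow> real \<Rightarrow> real" where
  "logistic lam r = lam * r * (1 - r)"

text \<open>
  A partial map, since its values may leave its domain \<open>(0,\<infinity>) \<times> S\<^sup>1\<close>; hence
  \<open>skew \<alpha> lam \<circ>\<^sub>m skew \<alpha> lam\<close> is defined only at the points of \<open>(0,\<infinity>) \<times> S\<^sup>1\<close> whose image
  lies in \<open>(0,\<infinity>) \<times> S\<^sup>1\<close> again.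
\<close>

definition skew :: "real \<Rightarrow> real \<Rightarrow> real \<times> circ \<rightharpoonup> real \<times> circ" where
  "skew \<alpha> lam = (\<lambda>(r, t). if r > 0 then Some (logistic lam r, rot \<alpha> t) else None)"

text \<open>The image of the part of \<open>A\<close> on which the partial map \<open>g\<close> is defined.\<close>

definition map_image :: "('a \<rightharpoonup> 'b) \<Rightarrow> 'a set \<Rightarrow> 'b set" where
  "map_image g A = ran (g |` A)"

definition invariant_wrt :: "('a \<rightharpoonup> 'a) \<Rightarrow> 'a set \<Rightarrow> bool" where
  "invariant_wrt g A \<longleftrightarrow> A \<subseteq> dom g \<and> map_image g A = A"

definition is_circle :: "(real \<times> circ) set \<Rightarrow> bool" where
  "is_circle G \<longleftrightarrow> G homeomorphic (UNIV :: circ set)"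

end

theory Submission
  imports Defs
begin

text \<open>
  The radial coordinate evolves independently of the angle, and it evolves by the logistic map.
  Just above \<open>\<lambda> = 3\<close> the fixed point of that map has undergone a period-doubling bifurcation, and
  an orbit \<open>p \<leftrightarrow> q\<close> of period two has appeared; it is explicit, and it exists in \<open>(0,\<infinity>)\<close> for every
  \<open>\<lambda> > 3\<close> (\<open>logistic_two_cycle\<close>). A rotation maps the angular circle onto itself, so the skew
  product carries the whole circle over a radius \<open>r > 0\<close> onto the circle over the image of \<open>r\<close>
  (\<open>map_image_skew_fibre\<close>). The circles over \<open>p\<close> and \<open>q\<close> are therefore interchanged, and the second
  iterate preserves each of them.
\<close>

lemma logistic_two_cycle:
  assumes "lam > 3"
  obtains p q where "p > 0" "q > 0" "p \<noteq> q" "logistic lam p = q" "logistic lam q = p"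
proof -
  \<comment> \<open>Dividing the equation for a point of period two by the equation for a fixed point leaves
    \<open>\<lambda>\<^sup>2 r\<^sup>2 - \<lambda> (\<lambda> + 1) r + (\<lambda> + 1) = 0\<close>, whose discriminant is \<open>\<lambda>\<^sup>2 (\<lambda> + 1) (\<lambda> - 3)\<close>.\<close>
  define s where "s = sqrt ((lam + 1) * (lam - 3))"
  define p where "p = (lam + 1 + s) / (2 * lam)"
  define q where "q = (lam + 1 - s) / (2 * lam)"
  have s_pos: "s > 0"
    using assms by (simp add: s_def)
  have s_sq: "s * s = (lam + 1) * (lam - 3)"
    using assms by (simp add: s_def)
  have s_less: "s < lam + 1"
    unfolding s_def using assms
    by (intro real_less_lsqrt) (auto simp: power2_eq_square intro!: mult_strict_left_mono)
  have "logistic lam p = (lam\<^sup>2 - 1 - 2 * s - s * s) / (4 * lam)"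
    using assms by (simp add: logistic_def p_def field_simps power2_eq_square)
  also have "\<dots> = q"
    using assms by (simp add: s_sq q_def field_simps power2_eq_square)
  finally have pq: "logistic lam p = q" .
  have "logistic lam q = (lam\<^sup>2 - 1 + 2 * s - s * s) / (4 * lam)"
    using assms by (simp add: logistic_def q_def field_simps power2_eq_square)
  also have "\<dots> = p"
    using assms by (simp add: s_sq p_def field_simps power2_eq_square)
  finally have qp: "logistic lam q = p" .
  show thesis
  proof (rule that[OF _ _ _ pq qp])
    show "p > 0" "q > 0" "p \<noteq> q"
      using assms s_pos s_less by (auto simp: p_def q_def)
  qed
qed

lemma rot_rot_minus: "rot \<alpha> (rot (- \<alpha>) t) = t"
  by transfer simp

lemma surj_rot: "surj (rot \<alpha>)"
  by (metis rot_rot_minus surjI)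

lemma map_image_iff: "y \<in> map_image g A \<longleftrightarrow> (\<exists>x\<in>A. g x = Some y)"
  by (auto simp: map_image_def ran_def restrict_map_def)

lemma map_image_total: "map_image (\<lambda>x. Some (h x)) A = h ` A"
  by (auto simp: map_image_iff)

lemma map_image_cong:
  assumes "\<And>x. x \<in> A \<Longrightarrow> g x = h x"
  shows "map_image g A = map_image h A"
  using assms by (auto simp: map_image_iff)

lemma map_image_Un: "map_image g (A \<union> B) = map_image g A \<union> map_image g B"
  by (auto simp: map_image_iff)

lemma map_image_map_comp: "map_image (g \<circ>\<^sub>m f) A = map_image g (map_image f A)"
  by (auto simp: set_eq_iff map_image_iff map_comp_Some_iff Bex_def)

text \<open>
  Invariance asks that the second iterate be defined on all of \<open>A\<close>, which the equality of images
  alone does not give: \<^const>\<open>map_image\<close> discards the points where the map is undefined.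
\<close>

lemma invariant_wrt_square_if_swapped:
  assumes "A \<subseteq> dom f" "B \<subseteq> dom f" "map_image f A = B" "map_image f B = A"
  shows "invariant_wrt (f \<circ>\<^sub>m f) A"
proof -
  have "x \<in> dom (f \<circ>\<^sub>m f)" if x: "x \<in> A" for x
  proof -
    obtain y where y: "f x = Some y"
      using assms(1) x by blast
    then have "y \<in> B"
      using x assms(3) by (auto simp: map_image_iff)
    then show ?thesis
      using assms(2) y by (auto simp: map_comp_def)
  qed
  then show ?thesis
    using assms(3,4) by (auto simp: invariant_wrt_def map_image_map_comp)
qed

lemma fibre_subset_dom_skew:
  assumes "r > 0"
  shows "{r} \<times> UNIV \<subseteq> dom (skew \<alpha> lam)"
  using assms by (auto simp: skew_def)

lemma map_image_skew_fibre:
  assumes "r > 0"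
  shows "map_image (skew \<alpha> lam) ({r} \<times> UNIV) = {logistic lam r} \<times> UNIV"
proof -
  have "map_image (skew \<alpha> lam) ({r} \<times> UNIV)
      = map_image (\<lambda>x. Some (map_prod (logistic lam) (rot \<alpha>) x)) ({r} \<times> UNIV)"
    using assms by (intro map_image_cong) (auto simp: skew_def)
  also have "\<dots> = {logistic lam r} \<times> range (rot \<alpha>)"
    by (auto simp: map_image_total)
  finally show ?thesis
    by (simp add: surj_rot)
qed

lemma is_circle_fibre: "is_circle ({r} \<times> UNIV)"
  unfolding is_circle_def homeomorphic_def homeomorphism_def
proof (intro exI conjI)
  show "continuous_on ({r} \<times> UNIV) (snd :: real \<times> circ \<Rightarrow> circ)"
    by (intro continuous_intros)
  show "continuous_on UNIV (Pair r :: circ \<Rightarrow> real \<times> circ)"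
    by (intro continuous_intros)
qed auto

theorem theorem1:
  fixes \<alpha> :: real
  assumes "\<alpha> \<notin> \<rat>"
  shows "\<exists>lam0 > 3. \<forall>lam. 3 < lam \<and> lam < lam0 \<longrightarrow>
    (\<exists>G1 G2. G1 \<subseteq> {0<..} \<times> UNIV \<and> G2 \<subseteq> {0<..} \<times> UNIV \<and>
      is_circle G1 \<and> is_circle G2 \<and>
      invariant_wrt (skew \<alpha> lam \<circ>\<^sub>m skew \<alpha> lam) G1 \<and>
      invariant_wrt (skew \<alpha> lam \<circ>\<^sub>m skew \<alpha> lam) G2 \<and>
      G1 \<inter> G2 = {} \<and>
      map_image (skew \<alpha> lam) G1 = G2 \<and> map_image (skew \<alpha> lam) G2 = G1 \<and>
      map_image (skew \<alpha> lam) (G1 \<union> G2) = G1 \<union> G2)"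
proof (intro exI[of _ 4] conjI allI impI)
  \<comment> \<open>The two-cycle exists for all \<open>\<lambda> > 3\<close>, so any bound above 3 will do.\<close>
  show "(4 :: real) > 3"
    by simp
  fix lam :: real
  assume lam: "3 < lam \<and> lam < 4"
  then obtain p q where pos: "p > 0" "q > 0" and "p \<noteq> q"
    and cycle: "logistic lam p = q" "logistic lam q = p"
    using logistic_two_cycle by blast
  let ?F = "skew \<alpha> lam"
  let ?P = "{p} \<times> (UNIV :: circ set)"
  let ?Q = "{q} \<times> (UNIV :: circ set)"
  have PQ: "map_image ?F ?P = ?Q" and QP: "map_image ?F ?Q = ?P"
    using map_image_skew_fibre[OF pos(1)] map_image_skew_fibre[OF pos(2)] by (simp_all add: cycle)
  note dom_P = fibre_subset_dom_skew[OF pos(1)] and dom_Q = fibre_subset_dom_skew[OF pos(2)]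
  have "invariant_wrt (?F \<circ>\<^sub>m ?F) ?P" "invariant_wrt (?F \<circ>\<^sub>m ?F) ?Q"
    using invariant_wrt_square_if_swapped[OF dom_P dom_Q PQ QP]
      invariant_wrt_square_if_swapped[OF dom_Q dom_P QP PQ] by auto
  moreover have "?P \<subseteq> {0<..} \<times> UNIV" "?Q \<subseteq> {0<..} \<times> UNIV" "?P \<inter> ?Q = {}"
    using pos \<open>p \<noteq> q\<close> by auto
  moreover have "map_image ?F (?P \<union> ?Q) = ?P \<union> ?Q"
    by (simp only: map_image_Un PQ QP Un_commute)
  ultimately show "\<exists>G1 G2. G1 \<subseteq> {0<..} \<times> UNIV \<and> G2 \<subseteq> {0<..} \<times> UNIV \<and>
      is_circle G1 \<and> is_circle G2 \<and>
      invariant_wrt (?F \<circ>\<^sub>m ?F) G1 \<and> invariant_wrt (?F \<circ>\<^sub>m ?F) G2 \<and>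
      G1 \<inter> G2 = {} \<and>
      map_image ?F G1 = G2 \<and> map_image ?F G2 = G1 \<and>
      map_image ?F (G1 \<union> G2) = G1 \<union> G2"
    using is_circle_fibre[of p] is_circle_fibre[of q] PQ QP
    by - (rule exI[of _ ?P], rule exI[of _ ?Q], intro conjI; assumption)
qed

end
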